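(* Let $\mathbf{s}_1,\dots,\mathbf{s}_M\in\mathbb{R}^n$ be any constellation or code, let $i\ne j$, and let $\Pr\{\mathbf{s}_i\to\mathbf{s}_j\}$ be the pairwise error probability (PEP) of the maximum likelihood detector in the AWGN channel, regarded as a function of the SNR $\gamma=1/\sigma_0^2$. Then: (a) For any constellation/code, $\Pr\{\mathbf{s}_i\to\mathbf{s}_j\}$ is a convex function of the SNR in the high SNR/low noise region $\gamma\ge (n+\sqrt{2n})/d_{\min,i}^2$ or, equivalently, $d_{\min,i}^2\ge (n+\sqrt{2n})\sigma_0^2$. (b) For $n=1,2$, it is concave in the low SNR region $\gamma\le (n+\sqrt{2n})/(d_{ij}+d_{\max,j})^2$, and there is an odd number of inflection points, $\Pr\{\mathbf{s}_i\to\mathbf{s}_j\}''=0$ (second derivative in $\gamma$), in the intermediate SNR mode $$\frac{n+\sqrt{2n}}{(d_{ij}+d_{\max,j})^2}\le\gamma\le\frac{n+\sqrt{2n}}{d_{\min,i}^2}.$$ (c) For $n>2$, the PEP is convex in the low SNR region $\gamma\le (n-\sqrt{2n})/(d_{ij}+d_{\max,j})^2$, and there is an even number of inflection points in-between, $$\frac{n-\sqrt{2n}}{(d_{ij}+d_{\max,j})^2}\le\gamma\le\frac{n+\sqrt{2n}}{d_{\min,i}^2}.$$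
   Context: Channel: $\mathbf{r}=\mathbf{s}+\boldsymbol{\xi}$, where $\mathbf{s}\in\{\mathbf{s}_1,\dots,\mathbf{s}_M\}\subset\mathbb{R}^n$ is the transmitted point and $\boldsymbol{\xi}\sim\mathcal{N}(\mathbf{0},\sigma_0^2\mathbf{I})$ has density $p_\xi(\mathbf{x})=(2\pi\sigma_0^2)^{-n/2}e^{-|\mathbf{x}|^2/(2\sigma_0^2)}$, with $|\cdot|$ the Euclidean norm and $\sigma_0^2$ the noise variance per dimension. The constellation is normalized by $\frac1M\sum_{k=1}^M|\mathbf{s}_k|^2=1$ and the SNR is $\gamma=1/\sigma_0^2$; the constellation is fixed while $\gamma$ varies. Codewords of a code under maximum likelihood decoding are regarded as points of a constellation, so codes are included. The maximum likelihood (minimum distance) detector outputs $\hat{\mathbf{s}}=\arg\min_{\mathbf{s}_k}|\mathbf{r}-\mathbf{s}_k|$. The decision region of $\mathbf{s}_k$ is its Voronoi cell $V_k=\{\mathbf{r}\in\mathbb{R}^n: |\mathbf{r}-\mathbf{s}_k|\le|\mathbf{r}-\mathbf{s}_l|\ \forall l\}$. The pairwise error probability is $$\Pr\{\mathbf{s}_i\to\mathbf{s}_j\}=\Pr[\hat{\mathbf{s}}=\mathbf{s}_j\mid\mathbf{s}=\mathbf{s}_i]=\int_{\Omega_j}p_\xi(\mathbf{x})\,d\mathbf{x},\qquad \Omega_j=V_j-\mathbf{s}_i,$$ i.e. $\Omega_j$ is the decision region of $\mathbf{s}_j$ when the reference frame is centered at $\mathbf{s}_i$. Notation: $d_{\min,i}$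 is the minimum distance from $\mathbf{s}_i$ to the boundary of its decision region (equal to $\min_{k\ne i}\frac12|\mathbf{s}_k-\mathbf{s}_i|$); $d_{\max,j}$ is the maximum distance from $\mathbf{s}_j$ to the boundary of its decision region; $d_{ij}=|\mathbf{s}_i-\mathbf{s}_j|$ is the distance between $\mathbf{s}_i$ and $\mathbf{s}_j$.
   Formalization: Parts (b) and (c) assume the decision region of s_j is bounded: otherwise for n≥2 the maximum d_max,j does not exist, and for n=1 the claim is false (s=−1,1 gives PEP=Q(√γ), convex for all γ>0, with no inflection points). *)

theory Defs
  imports "HOL-Analysis.Analysis"
begin

definition decision_region :: "(nat \<Rightarrow> real^'n) \<Rightarrow> nat \<Rightarrow> nat \<Rightarrow> (real^'n) set" where
  "decision_region s M k = {r. \<forall>l\<in>{1..M}. norm (r - s k) \<le> norm (r - s l)}"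

text \<open>The parameter \<open>v\<close> is the noise variance per dimension (not the standard deviation).\<close>

definition noise_density :: "real \<Rightarrow> real^'n \<Rightarrow> real" where
  "noise_density v x =
     (2 * pi * v) powr (- real CARD('n) / 2) * exp (- (norm x)\<^sup>2 / (2 * v))"

text \<open>Cells overlap only in null sets, so ties in the detector do not affect the integral.\<close>

definition pep :: "(nat \<Rightarrow> real^'n) \<Rightarrow> nat \<Rightarrow> nat \<Rightarrow> nat \<Rightarrow> real \<Rightarrow> real" where
  "pep s M i j v =
     (LINT x:((\<lambda>r. r - s i) ` decision_region s M j)|lborel. noise_density v x)"

definition pep_snr :: "(nat \<Rightarrow> real^'n) \<Rightarrow> nat \<Rightarrow> nat \<Rightarrow> nat \<Rightarrow> real \<Rightarrow> real" where
  "pep_snr s M i j \<gamma> = pep s M i j (1 / \<gamma>)"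

definition d_min :: "(nat \<Rightarrow> real^'n) \<Rightarrow> nat \<Rightarrow> nat \<Rightarrow> real" where
  "d_min s M i = infdist (s i) (frontier (decision_region s M i))"

text \<open>Meaningful only for a bounded cell: the frontier is then nonempty and compact, and the
  supremum is a maximum.\<close>

definition d_max :: "(nat \<Rightarrow> real^'n) \<Rightarrow> nat \<Rightarrow> nat \<Rightarrow> real" where
  "d_max s M j = (SUP r\<in>frontier (decision_region s M j). dist (s j) r)"

text \<open>An inflection point is a zero of the second derivative at which the curvature changes sign;
  a zero without sign change does not count.  Both derivatives are required to exist near
  \<open>x\<close>.\<close>

definition inflection_point :: "(real \<Rightarrow> real) \<Rightarrow> real \<Rightarrow> bool" where
  "inflection_point f x \<longleftrightarrow>
     (\<exists>f' f''.
        (\<forall>\<^sub>F y in nhds x. (f has_real_derivative f' y) (at y) \<and>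
                        (f' has_real_derivative f'' y) (at y)) \<and>
        f'' x = 0 \<and>
        ((\<forall>\<^sub>F y in at_left x. f'' y < 0) \<and> (\<forall>\<^sub>F y in at_right x. f'' y > 0) \<or>
         (\<forall>\<^sub>F y in at_left x. f'' y > 0) \<and> (\<forall>\<^sub>F y in at_right x. f'' y < 0)))"

end

theory Submission
  imports Defs "HOL-Complex_Analysis.Conformal_Mappings" "HOL-Probability.Distributions"
begin

text \<open>Up to a positive factor, the second SNR-derivative of the Gaussian density at \<open>x\<close> is
  \<open>(\<gamma>|x|\<^sup>2 - n)\<^sup>2 - 2n\<close>, whose sign is constant on the whole error region in the low and high
  SNR regimes; integrating gives convexity and concavity.  For a bounded error region the
  probability is \<open>\<gamma> powr (n / 2)\<close> times the Laplace transform of a measure with compact support,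
  an entire function given by its power series.  Its curvature therefore has finitely many
  zeros in a compact interval, and the parity of the number of sign changes is read off from
  the strict signs at the two endpoints, which are strict because spheres are null sets.\<close>

section \<open>Geometry of decision regions\<close>

lemma decision_region_eq_INT:
  "decision_region s M k = (\<Inter>l\<in>{1..M}. {r. norm (r - s k) \<le> norm (r - s l)})"
  by (auto simp: decision_region_def)

lemma closed_decision_region: "closed (decision_region s M k)"
  unfolding decision_region_eq_INT by (intro closed_INT ballI closed_Collect_le continuous_intros)

text \<open>The competitors are finitely many, so the strict inequalities against them cut out an
  open set; it contains \<open>s k\<close> because the points are distinct.\<close>

lemma center_in_interior_decision_region:
  fixes s :: "nat \<Rightarrow> real^'n"
  assumes "inj_on s {1..M}" "k \<in> {1..M}"
  shows "s k \<in> interior (decision_region s M k)"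
proof -
  define U where "U = (\<Inter>l\<in>{1..M} - {k}. {r. norm (r - s k) < norm (r - s l)})"
  have "open U"
    unfolding U_def by (intro open_INT ballI open_Collect_less continuous_intros) auto
  moreover have "U \<subseteq> decision_region s M k"
    by (auto simp: U_def decision_region_def intro: less_imp_le)
  moreover have "s k \<in> U"
    using assms inj_on_eq_iff[OF assms(1), of k] by (simp add: U_def)
  ultimately show ?thesis by (blast intro: interiorI)
qed

text \<open>Moving a point by \<open>t\<close> times \<open>u = s j - s i\<close> raises the
  difference of its squared distances to \<open>s i\<close> and \<open>s j\<close> by
  \<open>2 * t * (u \<bullet> u)\<close>. On the cell of \<open>s j\<close> the difference is
  already nonnegative, so a short move leaves the cell of \<open>s i\<close>, which is impossible at
  an interior point of the latter.\<close>

lemma interior_decision_region_disjoint: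
  fixes s :: "nat \<Rightarrow> real^'n"
  assumes "s i \<noteq> s j" "i \<in> {1..M}" "j \<in> {1..M}"
  shows "interior (decision_region s M i) \<inter> decision_region s M j = {}"
proof (rule ccontr)
  assume "\<not> ?thesis"
  then obtain r where r: "r \<in> interior (decision_region s M i)" "r \<in> decision_region s M j"
    by blast
  obtain e where e: "e > 0" "cball r e \<subseteq> decision_region s M i"
    using r(1) by (meson mem_interior_cball)
  define u where "u = s j - s i"
  have u: "norm u > 0" using assms(1) by (simp add: u_def)
  \<comment> \<open>The move has length \<open>e\<close>, the largest that stays in the closed
    ball.\<close>
  define t where "t = e / norm u"
  have t: "t > 0" using e u by (simp add: t_def)
  have "r + t *\<^sub>R u \<in> cball r e"
    using e u by (simp add: dist_norm t_def)
  then have "norm (r + t *\<^sub>R u - s i) \<le> norm (r + t *\<^sub>R u - s j)"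
    using e(2) assms by (auto simp: decision_region_def)
  then have 1: "(r + t *\<^sub>R u - s i) \<bullet> (r + t *\<^sub>R u - s i)
      \<le> (r + t *\<^sub>R u - s j) \<bullet> (r + t *\<^sub>R u - s j)"
    by (simp add: norm_le)
  have "norm (r - s j) \<le> norm (r - s i)"
    using r(2) assms by (auto simp: decision_region_def)
  then have 2: "(r - s j) \<bullet> (r - s j) \<le> (r - s i) \<bullet> (r - s i)"
    by (simp add: norm_le)
  have "(r + t *\<^sub>R u - s i) \<bullet> (r + t *\<^sub>R u - s i) - (r + t *\<^sub>R u - s j) \<bullet> (r + t *\<^sub>R u - s j)
     = (r - s i) \<bullet> (r - s i) - (r - s j) \<bullet> (r - s j) + 2 * t * (u \<bullet> u)"
    by (simp add: u_def inner_simps inner_commute algebra_simps)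
  moreover have "2 * t * (u \<bullet> u) > 0"
    using t u by simp
  ultimately show False using 1 2 by linarith
qed

section \<open>Distance from the transmitted point to another cell\<close>

context
  fixes s :: "nat \<Rightarrow> real^'n" and M i j :: nat
  assumes inj: "inj_on s {1..M}" and i: "i \<in> {1..M}" and j: "j \<in> {1..M}" and ij: "i \<noteq> j"
begin

lemma distinct_points: "s i \<noteq> s j"
  using inj_on_eq_iff[OF inj i j] ij by simp

text \<open>The centre is interior to its cell, hence off the closed frontier. The frontier must
  also be shown nonempty, since \<open>infdist\<close> to the empty set is 0 by convention; it is,
  because the cell contains \<open>s i\<close> but misses \<open>s j\<close>.\<close>

lemma d_min_pos: "d_min s M i > 0"
  unfolding d_min_def
proof (rule infdist_pos_not_in_closed)
  have "s i \<in> interior (decision_region s M i)" "s j \<in> interior (decision_region s M j)"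
    using inj i j by (simp_all add: center_in_interior_decision_region)
  moreover from this have "s j \<notin> interior (decision_region s M i)"
    using interior_decision_region_disjoint[of s i j M] distinct_points i j interior_subset by blast
  ultimately have "decision_region s M i \<noteq> UNIV" "decision_region s M i \<noteq> {}"
      "s i \<notin> frontier (decision_region s M i)"
    using interior_subset by (auto simp: frontier_def)
  then show "s i \<notin> frontier (decision_region s M i)"
    "frontier (decision_region s M i) \<noteq> {}"
    by (simp_all add: frontier_eq_empty)
qed simp

text \<open>The open ball of radius \<open>d_min\<close> about \<open>s i\<close> is connected,
  meets the cell of \<open>s i\<close> and avoids its frontier, so it lies in the interior of that
  cell, which no point of another cell can enter.\<close>

lemma d_min_le_dist:
  assumes r: "r \<in> decision_region s M j"
  shows "d_min s M i \<le> dist (s i) r"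
proof (rule ccontr)
  assume "\<not> ?thesis"
  then have rb: "r \<in> ball (s i) (d_min s M i)" by simp
  have "ball (s i) (d_min s M i) \<inter> frontier (decision_region s M i) = {}"
    unfolding d_min_def by (auto dest: infdist_le[where x="s i"])
  moreover have "s i \<in> ball (s i) (d_min s M i) \<inter> decision_region s M i"
    using d_min_pos by (auto simp: decision_region_def)
  ultimately have "ball (s i) (d_min s M i) \<subseteq> decision_region s M i"
    using connected_Int_frontier[OF connected_ball] by blast
  then have "ball (s i) (d_min s M i) \<subseteq> interior (decision_region s M i)"
    by (simp add: interior_maximal)
  then show False
    using rb r interior_decision_region_disjoint[of s i j M] distinct_points i j by blast
qed

end

text \<open>\<open>d_max\<close> sees only the frontier. An interior point is pushed along the ray
  from \<open>s j\<close> until it hits the frontier, which scales its displacement from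
  \<open>s j\<close> by \<open>1 + d\<close>.\<close>

lemma dist_le_d_max:
  fixes s :: "nat \<Rightarrow> real^'n"
  assumes bdd: "bounded (decision_region s M j)" and r: "r \<in> decision_region s M j"
  shows "dist (s j) r \<le> d_max s M j"
proof -
  let ?V = "decision_region s M j"
  have "frontier ?V \<subseteq> ?V"
    using closed_decision_region by (rule frontier_subset_closed)
  with bdd have "bounded (frontier ?V)"
    by (rule bounded_subset)
  then have "bdd_above (dist (s j) ` frontier ?V)"
    unfolding bounded_any_center[of _ "s j"] by (auto intro: bdd_aboveI2)
  then have sup: "dist (s j) y \<le> d_max s M j" if "y \<in> frontier ?V" for y
    unfolding d_max_def using that by (intro cSUP_upper)
  show ?thesis
  proof (cases "r \<in> interior ?V")
    case False
    then show ?thesis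
      using r sup closure_subset by (auto simp: frontier_def)
  next
    case True
    \<comment> \<open>At the centre itself any direction serves: a single frontier point already
      shows that the supremum is nonnegative.\<close>
    obtain v :: "real^'n" where v: "v \<noteq> 0" "r = s j \<or> v = r - s j"
      by (cases "r = s j") (auto intro: that[of 1] that[of "r - s j"])
    obtain d where d: "0 < d" "r + d *\<^sub>R v \<in> frontier ?V"
      by (rule ray_to_frontier[OF bdd True v(1)])
    show ?thesis
    proof (cases "r = s j")
      case True
      then show ?thesis using order_trans[OF zero_le_dist sup[OF d(2)]] by simp
    next
      case False
      then have "r + d *\<^sub>R v = s j + (1 + d) *\<^sub>R (r - s j)"
        using v(2) by (auto simp: algebra_simps)
      then have "dist (s j) (r + d *\<^sub>R v) = norm ((1 + d) *\<^sub>R (r - s j))"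
        by (simp add: dist_norm norm_minus_commute)
      also have "\<dots> = (1 + d) * dist (s j) r"
        using d by (simp add: dist_norm norm_minus_commute)
      finally have "dist (s j) r \<le> dist (s j) (r + d *\<^sub>R v)"
        using d(1) by (simp add: algebra_simps)
      with sup[OF d(2)] show ?thesis by simp
    qed
  qed
qed

section \<open>Laplace moments and Gaussian integrability\<close>

text \<open>The \<open>m\<close>-th derivative of the Laplace transform of the law of
  \<open>u\<close>. It is generic in the field, so that real calculus and complex analysis apply to
  the same object.\<close>

definition laplace_moment ::
    "'b measure \<Rightarrow> ('b \<Rightarrow> real) \<Rightarrow> nat \<Rightarrow> 'a \<Rightarrow> 'a::{real_normed_field, banach, second_countable_topology}" where
  "laplace_moment \<mu> u m z = (LINT x|\<mu>. of_real (u x) ^ m * exp (of_real (u x) * z))"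

context
  fixes \<mu> :: "'b measure" and u :: "'b \<Rightarrow> real" and B :: real
  assumes fin: "finite_measure \<mu>" and meas [measurable]: "u \<in> borel_measurable \<mu>"
    and bound: "\<forall>x\<in>space \<mu>. \<bar>u x\<bar> \<le> B"
begin

lemma integrable_power_bounded: "integrable \<mu> (\<lambda>x. u x ^ k)"
proof -
  have "AE x in \<mu>. norm (u x ^ k) \<le> B ^ k"
    using bound by (intro AE_I2) (auto simp: norm_power power_abs intro!: power_mono)
  then show ?thesis by (rule finite_measure.integrable_const_bound[OF fin]) simp
qed

text \<open>The exponential is expanded and integrated term by term. Since \<open>u\<close> is
  bounded by \<open>B\<close> and the measure is finite, the exponential series at
  \<open>B * norm z\<close> dominates, so the expansion holds for every \<open>z\<close>.\<close>

lemma laplace_moment_sums: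
  fixes z :: "'a::{real_normed_field, banach, second_countable_topology}"
  shows "(\<lambda>k. of_real ((LINT x|\<mu>. u x ^ (m + k)) / fact k) * z ^ k) sums laplace_moment \<mu> u m z"
proof -
  let ?f = "\<lambda>k x. of_real (u x ^ (m + k)) * (z ^ k / fact k) :: 'a"
  have int: "integrable \<mu> (?f k)" for k
    by (intro integrable_mult_left integrable_of_real integrable_power_bounded)
  have nle: "norm (?f k x) \<le> B ^ m * ((B * norm z) ^ k /\<^sub>R fact k)" if "x \<in> space \<mu>" for k x
  proof -
    have "norm (?f k x) = \<bar>u x\<bar> ^ m * ((\<bar>u x\<bar> * norm z) ^ k / fact k)"
      by (simp add: norm_mult norm_divide norm_power power_add power_mult_distrib power_abs abs_mult)
    also have "\<dots> \<le> B ^ m * ((B * norm z) ^ k / fact k)"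
      using bspec[OF bound that] by (intro mult_mono divide_right_mono power_mono) auto
    finally show ?thesis by (simp add: divide_inverse_commute)
  qed
  have summ: "summable (\<lambda>k. B ^ m * ((B * norm z) ^ k /\<^sub>R fact k))"
    by (intro summable_mult summable_exp_generic)
  have "(\<lambda>k. integral\<^sup>L \<mu> (?f k)) sums (LINT x|\<mu>. (\<Sum>k. ?f k x))"
  proof (rule sums_integral[OF int])
    show "AE x in \<mu>. summable (\<lambda>k. norm (?f k x))"
      using nle by (intro AE_I2 summable_comparison_test[OF _ summ]) auto
    have "(LINT x|\<mu>. norm (?f k x))
        \<le> (LINT x|\<mu>. B ^ m * ((B * norm z) ^ k /\<^sub>R fact k))" for k
      using nle int by (intro integral_mono finite_measure.integrable_const[OF fin]) auto
    then show "summable (\<lambda>k. LINT x|\<mu>. norm (?f k x))"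
      by (intro summable_comparison_test[OF _ summable_mult[OF summ, of "measure \<mu> (space \<mu>)"]])
        (auto intro!: exI[of _ 0] simp: mult.assoc)
  qed
  moreover have "integral\<^sup>L \<mu> (?f k) = of_real ((LINT x|\<mu>. u x ^ (m + k)) / fact k) * z ^ k" for k
  proof -
    have "(LINT x|\<mu>. of_real (u x ^ (m + k)) :: 'a) = of_real (LINT x|\<mu>. u x ^ (m + k))"
      by (rule integral_bounded_linear[OF bounded_linear_of_real integrable_power_bounded])
    then show ?thesis by simp
  qed
  moreover have "(\<Sum>k. ?f k x) = of_real (u x) ^ m * exp (of_real (u x) * z)" for x
  proof -
    have "(\<lambda>k. of_real (u x) ^ m * ((of_real (u x) * z) ^ k /\<^sub>R fact k))
        sums (of_real (u x) ^ m * exp (of_real (u x) * z))"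
      by (intro sums_mult exp_converges)
    then show ?thesis
      by (intro sums_unique[symmetric])
        (simp add: power_add power_mult_distrib scaleR_conv_of_real field_simps)
  qed
  ultimately show ?thesis by (simp only: laplace_moment_def)
qed

text \<open>Formal differentiation of the everywhere convergent series cancels one factor of the
  factorial and turns the coefficients for \<open>m\<close> into those for
  \<open>Suc m\<close>.\<close>

lemma has_field_derivative_laplace_moment:
  fixes z :: "'a::{real_normed_field, banach, second_countable_topology}"
  shows "(laplace_moment \<mu> u m has_field_derivative laplace_moment \<mu> u (Suc m) z) (at z)"
proof -
  define c where "c m k = (of_real ((LINT x|\<mu>. u x ^ (m + k)) / fact k) :: 'a)" for m k
  have sums: "(\<lambda>k. c m k * y ^ k) sums laplace_moment \<mu> u m y" for m y
    unfolding c_def by (rule laplace_moment_sums)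
  have "diffs (c m) = c (Suc m)"
    by (rule ext) (simp add: diffs_def c_def field_simps del: of_nat_Suc)
  moreover have "((\<lambda>x. \<Sum>k. c m k * x ^ k) has_field_derivative (\<Sum>k. diffs (c m) k * z ^ k)) (at z)"
    using sums by (intro termdiffs_strong_converges_everywhere) (rule sums_summable)
  ultimately show ?thesis
    by (simp add: sums_unique[OF sums, symmetric])
qed

lemma integrable_laplace_moment:
  fixes z :: real
  shows "integrable \<mu> (\<lambda>x. u x ^ m * exp (u x * z))"
proof -
  have "AE x in \<mu>. norm (u x ^ m * exp (u x * z)) \<le> B ^ m * exp (B * \<bar>z\<bar>)"
  proof (rule AE_I2)
    fix x assume "x \<in> space \<mu>"
    with bound have b: "\<bar>u x\<bar> \<le> B" by blast
    have "u x * z \<le> \<bar>u x\<bar> * \<bar>z\<bar>" by (metis abs_ge_self abs_mult)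
    also have "\<dots> \<le> B * \<bar>z\<bar>" using b by (rule mult_right_mono) simp
    finally show "norm (u x ^ m * exp (u x * z)) \<le> B ^ m * exp (B * \<bar>z\<bar>)"
      using b by (auto simp: abs_mult power_abs intro!: mult_mono power_mono)
  qed
  then show ?thesis by (rule finite_measure.integrable_const_bound[OF fin]) simp
qed

text \<open>Lets zeros on the real line be treated as zeros of an entire function.\<close>

lemma laplace_moment_of_real:
  "laplace_moment \<mu> u m (complex_of_real t) = of_real (laplace_moment \<mu> u m t)"
  unfolding laplace_moment_def
  by (simp add: integral_complex_of_real[symmetric] exp_of_real[symmetric])

end

text \<open>The squared norm is a sum over coordinates, so the integral factors into one-dimensional
  ones, each finite as a multiple of a normal density.\<close>

lemma integrable_gaussian:
  fixes c :: real
  assumes "c > 0"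
  shows "integrable lborel (\<lambda>x::'a::euclidean_space. exp (- c * (norm x)\<^sup>2))"
proof (rule integrableI_nonneg)
  \<comment> \<open>Chosen so that \<open>1 / (2 * \<sigma>\<^sup>2) = c\<close>.\<close>
  define \<sigma> where "\<sigma> = sqrt (1 / (2 * c))"
  have "\<sigma> > 0" using assms by (simp add: \<sigma>_def)
  then have "integrable lborel (\<lambda>x. sqrt (2 * pi * \<sigma>\<^sup>2) * normal_density 0 \<sigma> x)"
    by (intro integrable_mult_right integrable_normal_density)
  also have "(\<lambda>x. sqrt (2 * pi * \<sigma>\<^sup>2) * normal_density 0 \<sigma> x) = (\<lambda>x. exp (- c * x\<^sup>2))"
    using assms by (auto simp: normal_density_def \<sigma>_def field_simps)
  finally have fin: "(\<integral>\<^sup>+x. exp (- c * x\<^sup>2) \<partial>lborel) < \<infinity>"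
    by (simp add: integrable_iff_bounded)
  have "(norm x)\<^sup>2 = (\<Sum>b\<in>Basis. (x \<bullet> b)\<^sup>2)" for x :: 'a
    unfolding power2_norm_eq_inner by (subst euclidean_inner) (simp add: power2_eq_square)
  then have "exp (- c * (norm x)\<^sup>2) = (\<Prod>b\<in>Basis. exp (- c * (x \<bullet> b)\<^sup>2))" for x :: 'a
    by (simp add: exp_sum[symmetric] sum_distrib_left sum_negf)
  moreover have "(\<integral>\<^sup>+x. (\<Prod>b\<in>(Basis::'a set). ennreal (exp (- c * (x \<bullet> b)\<^sup>2))) \<partial>lborel)
      = (\<Prod>b\<in>(Basis::'a set). \<integral>\<^sup>+x. exp (- c * x\<^sup>2) \<partial>lborel)"
    by (rule nn_integral_lborel_prod) simp_all
  ultimately have "(\<integral>\<^sup>+x. exp (- c * (norm (x::'a))\<^sup>2) \<partial>lborel)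
      = (\<Prod>b\<in>(Basis::'a set). \<integral>\<^sup>+x. exp (- c * x\<^sup>2) \<partial>lborel)"
    by (simp add: prod_ennreal[symmetric])
  also have "\<dots> < \<infinity>" using fin by (simp add: power_less_top_ennreal)
  finally show "(\<integral>\<^sup>+x. exp (- c * (norm (x::'a))\<^sup>2) \<partial>lborel) < \<infinity>" .
qed auto

section \<open>Counting sign changes\<close>

text \<open>The sign clause of \<open>inflection_point\<close>, isolated so that it can be counted
  for any function.\<close>

definition sign_change :: "(real \<Rightarrow> real) \<Rightarrow> real \<Rightarrow> bool" where
  "sign_change h x \<longleftrightarrow>
     (\<forall>\<^sub>F y in at_left x. h y < 0) \<and> (\<forall>\<^sub>F y in at_right x. h y > 0) \<or>
     (\<forall>\<^sub>F y in at_left x. h y > 0) \<and> (\<forall>\<^sub>F y in at_right x. h y < 0)"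

text \<open>Along \<open>F\<close> the function keeps the sign of \<open>k\<close>. Properness of
  \<open>F\<close> keeps the opposite sign from holding vacuously.\<close>

lemma eventually_sign_iff:
  fixes h :: "'a \<Rightarrow> real"
  assumes "F \<noteq> bot" and ev: "eventually (\<lambda>y. h y * k > 0) F"
  shows "eventually (\<lambda>y. h y < 0) F \<longleftrightarrow> k < 0" "eventually (\<lambda>y. h y > 0) F \<longleftrightarrow> k > 0"
proof -
  have "k < 0" if "eventually (\<lambda>y. h y < 0) F"
    using eventually_happens[OF eventually_conj[OF ev that]] assms(1) by (auto simp: zero_less_mult_iff)
  moreover have "eventually (\<lambda>y. h y < 0) F" if "k < 0"
    using ev by eventually_elim (use that in \<open>auto simp: zero_less_mult_iff\<close>)
  ultimately show "eventually (\<lambda>y. h y < 0) F \<longleftrightarrow> k < 0" by blast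
  have "k > 0" if "eventually (\<lambda>y. h y > 0) F"
    using eventually_happens[OF eventually_conj[OF ev that]] assms(1) by (auto simp: zero_less_mult_iff)
  moreover have "eventually (\<lambda>y. h y > 0) F" if "k > 0"
    using ev by eventually_elim (use that in \<open>auto simp: zero_less_mult_iff\<close>)
  ultimately show "eventually (\<lambda>y. h y > 0) F \<longleftrightarrow> k > 0" by blast
qed

lemma sign_change_iff:
  assumes "c < z" "z < b"
    and left: "\<And>y. c \<le> y \<Longrightarrow> y < z \<Longrightarrow> h y * h c > 0"
    and right: "\<And>y. z < y \<Longrightarrow> y \<le> b \<Longrightarrow> h y * h b > 0"
  shows "sign_change h z \<longleftrightarrow> h c * h b < (0::real)"
proof -
  have l: "eventually (\<lambda>y. h y * h c > 0) (at_left z)"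
    using assms(1) by (intro eventually_at_leftI[OF left]) auto
  have r: "eventually (\<lambda>y. h y * h b > 0) (at_right z)"
    using assms(2) by (intro eventually_at_rightI[OF right]) auto
  show ?thesis
    unfolding sign_change_def
    by (simp add: eventually_sign_iff[OF _ l] eventually_sign_iff[OF _ r] mult_less_0_iff disj_commute)
qed

lemma same_sign_if_nonzero:
  fixes h :: "real \<Rightarrow> real"
  assumes "continuous_on {a..b} h" "a \<le> b" "\<And>x. x \<in> {a..b} \<Longrightarrow> h x \<noteq> 0"
  shows "h a * h b > 0"
proof (rule ccontr)
  assume "\<not> ?thesis"
  then have "h a \<le> 0 \<and> 0 \<le> h b \<or> h b \<le> 0 \<and> 0 \<le> h a"
    by (auto simp: not_less mult_le_0_iff)
  then obtain x where "a \<le> x" "x \<le> b" "h x = 0"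
    using IVT'[of h a 0 b] IVT2'[of h b 0 a] assms(1,2) by blast
  with assms(3) show False by auto
qed

text \<open>Induction on the number of zeros, with the right endpoint varying. Dropping the largest
  zero shortens the interval; that zero is counted exactly when \<open>h\<close> has opposite signs
  on its two sides, so both sides of the equivalence flip together.\<close>

lemma card_sign_changes_parity:
  fixes h :: "real \<Rightarrow> real"
  assumes "continuous_on {a..b} h" "finite {x\<in>{a..b}. h x = 0}" "a \<le> b" "h a \<noteq> 0" "h b \<noteq> 0"
  shows "even (card {x\<in>{a..b}. h x = 0 \<and> sign_change h x}) \<longleftrightarrow> h a * h b > 0"
  using assms
proof (induction "card {x\<in>{a..b}. h x = 0}" arbitrary: b rule: less_induct)
  case (less b)
  let ?Z = "\<lambda>b. {x\<in>{a..b}. h x = 0}"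
  let ?S = "\<lambda>b. {x\<in>{a..b}. h x = 0 \<and> sign_change h x}"
  show ?case
  proof (cases "?Z b = {}")
    case True
    then have S: "?S b = {}" by blast
    have "h a * h b > 0"
      using True less.prems by (intro same_sign_if_nonzero) auto
    then show ?thesis unfolding S by simp
  next
    case False
    define z where "z = Max (?Z b)"
    have z: "z \<in> ?Z b" and zmax: "\<And>x. x \<in> ?Z b \<Longrightarrow> x \<le> z"
      using Max_in[OF less.prems(2) False] Max_ge[OF less.prems(2)] by (auto simp: z_def)
    have az: "a < z" "z < b" using z less.prems by (auto simp: less_le)
    txt \<open>Peel off the largest zero \<open>z\<close>: the point \<open>c\<close> separates it from all the others.\<close>
    define c where "c = (Max (insert a (?Z b - {z})) + z) / 2"
    have fin: "finite (insert a (?Z b - {z}))" using less.prems(2) by simp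
    have "Max (insert a (?Z b - {z})) < z"
      using fin az zmax by (subst Max_less_iff) (auto simp: less_le)
    then have c: "c < z" "\<And>x. x \<in> insert a (?Z b - {z}) \<Longrightarrow> x < c"
      using Max_ge[OF fin] by (fastforce simp: c_def field_simps)+
    then have ac: "a < c" by simp
    have nz: "h x \<noteq> 0" if "c \<le> x" "x \<le> b" "x \<noteq> z" for x
      using c(2)[of x] that ac by auto
    have cont: "continuous_on {x..y} h" if "a \<le> x" "y \<le> b" for x y
      using that by (intro continuous_on_subset[OF less.prems(1)]) auto
    have left: "h y * h c > 0" if "c \<le> y" "y < z" for y
      using same_sign_if_nonzero[of c y h] cont[of c y] nz that ac az
      by (force simp: mult.commute)
    have right: "h y * h b > 0" if "z < y" "y \<le> b" for y
      using same_sign_if_nonzero[of y b h] cont[of y b] nz that ac c(1) by force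
    have sc: "sign_change h z \<longleftrightarrow> h c * h b < 0"
      using c(1) az(2) left right by (rule sign_change_iff)
    have "x < c \<longleftrightarrow> x \<noteq> z" if "x \<in> ?Z b" for x
      using that c(1) c(2)[of x] by auto
    then have Zc: "?Z c = ?Z b - {z}"
      using c(1) az nz[of c] by (auto simp: less_le)
    have "card (?Z c) < card (?Z b)"
      unfolding Zc using less.prems(2) z by (rule card_Diff1_less)
    then have IH: "even (card (?S c)) \<longleftrightarrow> h a * h c > 0"
    proof (rule less.hyps)
      show "continuous_on {a..c} h" using c(1) az by (intro cont) auto
      show "finite (?Z c)" using less.prems(2) Zc by simp
      show "h c \<noteq> 0" using nz[of c] c(1) az by auto
    qed (use ac less.prems in auto)
    have Sb: "?S b = ?S c \<union> (if sign_change h z then {z} else {})"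
      using Zc z by auto
    have zS: "z \<notin> ?S c" using c(1) by simp
    have "finite (?Z c)" unfolding Zc using less.prems(2) by simp
    then have fS: "finite (?S c)" by (rule rev_finite_subset) blast
    have "card (?S b) = card (?S c) + (if sign_change h z then 1 else 0)"
      unfolding Sb using zS fS by (auto simp: card_insert_if)
    moreover have "h c \<noteq> 0" using nz[of c] c(1) az by auto
    ultimately show ?thesis
      using IH sc less.prems by (auto simp: zero_less_mult_iff mult_less_0_iff linorder_neq_iff)
  qed
qed

section \<open>Curvature of Gaussian region probabilities\<close>

text \<open>The derivatives in \<open>inflection_point\<close> are existentially quantified, but
  uniqueness of derivatives forces them to agree near \<open>x\<close> with \<open>f'\<close> and
  the product of \<open>k\<close> and \<open>q\<close>. The positive factor \<open>k\<close> affects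
  neither zeros nor signs, so only \<open>q\<close> has to be studied.\<close>

lemma inflection_point_iff_sign_change:
  assumes S: "open S" "x \<in> S"
    and f: "\<And>y. y \<in> S \<Longrightarrow> (f has_real_derivative f' y) (at y)"
    and f': "\<And>y. y \<in> S \<Longrightarrow> (f' has_real_derivative k y * q y) (at y)"
    and k: "\<And>y. y \<in> S \<Longrightarrow> k y > 0"
  shows "inflection_point f x \<longleftrightarrow> q x = 0 \<and> sign_change q x"
proof -
  have evS: "eventually (\<lambda>y. y \<in> S) (nhds x)"
    using S by (rule eventually_nhds_in_open)
  have sign: "sign_change g x \<longleftrightarrow> sign_change q x"
    if g: "eventually (\<lambda>y. g y = k y * q y) (nhds x)" for g
  proof -
    have "eventually (\<lambda>y. (g y < 0 \<longleftrightarrow> q y < 0) \<and> (g y > 0 \<longleftrightarrow> q y > 0)) (nhds x)"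
      using g evS
    proof eventually_elim
      case (elim y)
      then show ?case using k[of y] by (auto simp: mult_less_0_iff zero_less_mult_iff)
    qed
    then have ev: "eventually (\<lambda>y. g y < 0 \<longleftrightarrow> q y < 0) (at x within A)"
      "eventually (\<lambda>y. g y > 0 \<longleftrightarrow> q y > 0) (at x within A)" for A
      by (auto simp: eventually_at_filter elim: eventually_mono)
    show ?thesis
      unfolding sign_change_def
      by (simp add: eventually_subst[OF ev(1)] eventually_subst[OF ev(2)])
  qed
  show ?thesis
  proof
    assume "inflection_point f x"
    then obtain f1 f2 where
      ev: "eventually (\<lambda>y. (f has_real_derivative f1 y) (at y) \<and>
                          (f1 has_real_derivative f2 y) (at y)) (nhds x)"
      and f2: "f2 x = 0" "sign_change f2 x"
      unfolding inflection_point_def sign_change_def by blast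
    have "eventually (\<lambda>y. f1 y = f' y) (nhds x)"
      using ev evS by eventually_elim (auto intro: DERIV_unique f)
    \<comment> \<open>Differentiating the equality at a nearby point \<open>y\<close> requires it on
      a whole neighbourhood of \<open>y\<close>, hence the nested filter.\<close>
    then have "eventually (\<lambda>y. eventually (\<lambda>z. f1 z = f' z) (nhds y)) (nhds x)"
      by (simp add: eventually_eventually)
    with ev evS have "eventually (\<lambda>y. f2 y = k y * q y) (nhds x)"
    proof eventually_elim
      case (elim y)
      then have "(f' has_real_derivative f2 y) (at y)"
        using DERIV_cong_ev[of y y f1 f' "f2 y" "f2 y"] by simp
      with f' elim show ?case by (blast intro: DERIV_unique)
    qed
    moreover from this have "f2 x = k x * q x" by (rule eventually_nhds_x_imp_x)
    ultimately show "q x = 0 \<and> sign_change q x"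
      using f2 k[OF S(2)] sign by auto
  next
    assume "q x = 0 \<and> sign_change q x"
    moreover have "sign_change (\<lambda>y. k y * q y) x \<longleftrightarrow> sign_change q x"
      by (rule sign) simp
    moreover have "eventually (\<lambda>y. (f has_real_derivative f' y) (at y) \<and>
        (f' has_real_derivative k y * q y) (at y)) (nhds x)"
      using evS by eventually_elim (simp add: f f')
    ultimately show "inflection_point f x"
      unfolding inflection_point_def sign_change_def by (intro exI conjI) auto
  qed
qed

text \<open>The product rule with \<open>g powr (p - 2)\<close> pulled out, leaving a bracket
  polynomial in \<open>g\<close>. It serves twice: with \<open>L\<close> an exponential for a single
  noise vector, and with \<open>L\<close> a Laplace transform for a whole region.\<close>

lemma powr_mult_second_derivative:
  fixes L L' L'' :: "real \<Rightarrow> real"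
  assumes "g > 0" and [derivative_intros]: "(L has_real_derivative L' g) (at g)"
    "(L' has_real_derivative L'' g) (at g)"
  shows "((\<lambda>g. K * (g powr p * L g)) has_real_derivative
      K * (p * g powr (p - 1) * L g + g powr p * L' g)) (at g)"
    and "((\<lambda>g. K * (p * g powr (p - 1) * L g + g powr p * L' g)) has_real_derivative
      K * g powr (p - 2) * (p * (p - 1) * L g + 2 * p * g * L' g + g\<^sup>2 * L'' g)) (at g)"
proof -
  show "((\<lambda>g. K * (g powr p * L g)) has_real_derivative
      K * (p * g powr (p - 1) * L g + g powr p * L' g)) (at g)"
    using \<open>g > 0\<close> by (auto intro!: derivative_eq_intros simp: algebra_simps)
  have p1: "g powr (p - 1) = g powr (p - 2) * g"
    using \<open>g > 0\<close> powr_add[of g "p - 2" 1] by simp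
  have p2: "g powr p = g powr (p - 2) * g\<^sup>2"
    using \<open>g > 0\<close> powr_add[of g "p - 2" 2] by (simp add: powr_numeral)
  have D: "((\<lambda>g. g powr r) has_real_derivative r * g powr (r - 1)) (at g)" for r
    using \<open>g > 0\<close> by (auto intro!: derivative_eq_intros)
  have "((\<lambda>g. K * (p * g powr (p - 1) * L g + g powr p * L' g)) has_real_derivative
      K * (p * (((p - 1) * g powr (p - 1 - 1)) * L g + g powr (p - 1) * L' g)
         + (p * g powr (p - 1) * L' g + g powr p * L'' g))) (at g)"
    using \<open>g > 0\<close> by (auto intro!: derivative_eq_intros D simp: algebra_simps)
  moreover have "p - 1 - 1 = p - 2" by simp
  ultimately show "((\<lambda>g. K * (p * g powr (p - 1) * L g + g powr p * L' g)) has_real_derivative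
      K * g powr (p - 2) * (p * (p - 1) * L g + 2 * p * g * L' g + g\<^sup>2 * L'' g)) (at g)"
    by (simp add: p1 p2 algebra_simps power2_eq_square)
qed

section \<open>Second SNR-derivative of the noise density at a point\<close>

lemma noise_density_snr:
  fixes x :: "real^'n"
  assumes "g > 0"
  shows "noise_density (1 / g) x = (2 * pi) powr (- real CARD('n) / 2) *
    (g powr (real CARD('n) / 2) * exp (- (norm x)\<^sup>2 / 2 * g))"
proof -
  have "(2 * pi * (1 / g)) powr (- real CARD('n) / 2)
      = (2 * pi) powr (- real CARD('n) / 2) * g powr (real CARD('n) / 2)"
    using assms by (simp add: powr_divide powr_minus field_simps)
  then show ?thesis by (simp add: noise_density_def)
qed

text \<open>Taken at \<open>t = g * (norm x)\<^sup>2\<close>, this has the sign of the second \<open>g\<close>-derivative of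
  \<open>g powr (n / 2) * exp (- g * (norm x)\<^sup>2 / 2)\<close>.\<close>

definition curvature :: "'n itself \<Rightarrow> real \<Rightarrow> real" where
  "curvature _ t = (t - real CARD('n))\<^sup>2 - 2 * real CARD('n)"

text \<open>A difference of squares; its two roots are the source of all SNR thresholds.\<close>

lemma curvature_factor:
  "curvature TYPE('n) t = (t - (real CARD('n) - sqrt (2 * real CARD('n))))
     * (t - (real CARD('n) + sqrt (2 * real CARD('n))))"
proof -
  have "sqrt (2 * real CARD('n)) * sqrt (2 * real CARD('n)) = 2 * real CARD('n)"
    by simp
  then show ?thesis unfolding curvature_def power2_eq_square by algebra
qed

text \<open>The derivatives stay abstract because later arguments use only that the second one is a
  positive factor times \<open>curvature\<close>.\<close>

lemma noise_density_second_derivative: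
  fixes x :: "real^'n"
  obtains f' f'' where
    "\<And>g. g > 0 \<Longrightarrow> ((\<lambda>g. noise_density (1 / g) x) has_real_derivative f' g) (at g)"
    "\<And>g. g > 0 \<Longrightarrow> (f' has_real_derivative f'' g * curvature TYPE('n) (g * (norm x)\<^sup>2)) (at g)"
    "\<And>g::real. g > 0 \<Longrightarrow> f'' g > 0"
proof -
  define p where "p = real CARD('n) / 2"
  define a where "a = - (norm x)\<^sup>2 / 2"
  define K where "K = (2 * pi) powr (- real CARD('n) / 2)"
  have K: "K > 0" by (simp add: K_def)
  define L where "L m g = a ^ m * exp (a * g)" for m :: nat and g
  have L: "(L m has_real_derivative L (Suc m) g) (at g)" for m g
    unfolding L_def by (auto intro!: derivative_eq_intros)
  note D = powr_mult_second_derivative[where K=K and p=p and L="L 0" and L'="L 1" and L''="L 2"]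
  have L01: "(L 0 has_real_derivative L 1 g) (at g)" "(L 1 has_real_derivative L 2 g) (at g)" for g
    using L[of 0 g] L[of 1 g] by (simp_all add: numeral_2_eq_2)
  show ?thesis
  proof
    fix g :: real assume g: "g > 0"
    have "((\<lambda>g. K * (g powr p * L 0 g)) has_real_derivative
      K * (p * g powr (p - 1) * L 0 g + g powr p * L 1 g)) (at g)"
      by (rule D(1)[OF g L01])
    moreover have "eventually (\<lambda>g. noise_density (1 / g) x = K * (g powr p * L 0 g)) (nhds g)"
      using eventually_nhds_in_open[of "{0<..}" g] g
      by (auto elim!: eventually_mono simp: noise_density_snr K_def p_def L_def a_def)
    ultimately show "((\<lambda>g. noise_density (1 / g) x) has_real_derivative
      K * (p * g powr (p - 1) * L 0 g + g powr p * L 1 g)) (at g)"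
      by (subst DERIV_cong_ev[OF refl _ refl]) auto
    \<comment> \<open>With \<open>t = g * (norm x)\<^sup>2\<close>, so that
      \<open>g * a = - t / 2\<close>, the bracket is \<open>((t - n)\<^sup>2 - 2 * n) / 4\<close>
      for dimension \<open>n\<close>.\<close>
    have e: "p * (p - 1) * L 0 g + 2 * p * g * L 1 g + g\<^sup>2 * L 2 g
      = exp (a * g) / 4 * curvature TYPE('n) (g * (norm x)\<^sup>2)"
      by (simp add: L_def a_def p_def curvature_def power2_eq_square field_simps)
    show "((\<lambda>g. K * (p * g powr (p - 1) * L 0 g + g powr p * L 1 g)) has_real_derivative
      K * g powr (p - 2) * (exp (a * g) / 4) * curvature TYPE('n) (g * (norm x)\<^sup>2)) (at g)"
      using D(2)[OF g L01] unfolding e by (simp only: mult.assoc)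
    show "K * g powr (p - 2) * (exp (a * g) / 4) > 0"
      using K g by simp
  qed
qed

text \<open>The defining inequality is integrated directly. This avoids differentiating under the
  integral sign, so unbounded regions are covered.\<close>

lemma convex_on_set_integral:
  fixes f :: "'a::real_vector \<Rightarrow> 'b \<Rightarrow> real"
  assumes "convex C" and int: "\<And>g. g \<in> C \<Longrightarrow> set_integrable M A (f g)"
    and conv: "\<And>x. x \<in> A \<Longrightarrow> convex_on C (\<lambda>g. f g x)"
  shows "convex_on C (\<lambda>g. LINT x:A|M. f g x)"
  unfolding convex_on_def
proof (intro conjI ballI allI impI)
  fix g h and u v :: real
  assume C: "g \<in> C" "h \<in> C" and uv: "0 \<le> u" "0 \<le> v" "u + v = 1"
  then have "u *\<^sub>R g + v *\<^sub>R h \<in> C" using \<open>convex C\<close> by (simp add: convex_def)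
  then have "(LINT x:A|M. f (u *\<^sub>R g + v *\<^sub>R h) x) \<le> (LINT x:A|M. u * f g x + v * f h x)"
    using C uv conv int
    by (intro set_integral_mono set_integral_add set_integrable_mult_right)
      (auto simp: convex_on_def)
  also have "\<dots> = u * (LINT x:A|M. f g x) + v * (LINT x:A|M. f h x)"
    using C int by (subst set_integral_add) (auto intro!: set_integrable_mult_right)
  finally show "(LINT x:A|M. f (u *\<^sub>R g + v *\<^sub>R h) x)
    \<le> u * (LINT x:A|M. f g x) + v * (LINT x:A|M. f h x)" .
qed fact

lemma concave_on_set_integral:
  fixes f :: "'a::real_vector \<Rightarrow> 'b \<Rightarrow> real"
  assumes "convex C" and "\<And>g. g \<in> C \<Longrightarrow> set_integrable M A (f g)"
    and "\<And>x. x \<in> A \<Longrightarrow> concave_on C (\<lambda>g. f g x)"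
  shows "concave_on C (\<lambda>g. LINT x:A|M. f g x)"
proof -
  have "convex_on C (\<lambda>g. LINT x:A|M. - f g x)"
    using assms by (intro convex_on_set_integral)
      (auto simp: concave_on_def set_integrable_def)
  then show ?thesis
    by (simp add: concave_on_def set_lebesgue_integral_def)
qed

lemma set_integrable_noise_density:
  fixes A :: "(real^'n) set"
  assumes "closed A" "v > 0"
  shows "set_integrable lborel A (noise_density v)"
proof -
  have "integrable lborel (\<lambda>x::real^'n. (2 * pi * v) powr (- real CARD('n) / 2) *
      exp (- (1 / (2 * v)) * (norm x)\<^sup>2))"
    using assms by (intro integrable_mult_right integrable_gaussian) simp
  then have "integrable lborel (noise_density v :: real^'n \<Rightarrow> real)"
    by (simp add: noise_density_def[abs_def])
  then show ?thesis
    unfolding set_integrable_def using assms(1) by (intro integrable_mult_indicator) auto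
qed

section \<open>Gaussian probability of a region as a function of the SNR\<close>

abbreviation region_measure :: "(real^'n) set \<Rightarrow> (real^'n) measure" where
  "region_measure A \<equiv> restrict_space lborel A"

definition region_prob :: "(real^'n) set \<Rightarrow> real \<Rightarrow> real" where
  "region_prob A g = (LINT x:A|lborel. noise_density (1 / g) x)"

definition exponent :: "real^'n \<Rightarrow> real" where
  "exponent x = - (norm x)\<^sup>2 / 2"

abbreviation region_moment ::
    "(real^'n) set \<Rightarrow> nat \<Rightarrow> 'a \<Rightarrow> 'a::{real_normed_field, banach, second_countable_topology}" where
  "region_moment A \<equiv> laplace_moment (region_measure A) exponent"

text \<open>For a bounded region this is the second derivative of \<open>region_prob\<close> up to a
  positive factor. The division by 4 makes it equal to the bracket left by the product rule.\<close>

definition region_curvature :: "(real^'n) set \<Rightarrow> real \<Rightarrow> real" where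
  "region_curvature A g = (LINT x|region_measure A.
     curvature TYPE('n) (g * (norm x)\<^sup>2) / 4 * exp (exponent x * g))"

lemma convex_on_region_prob:
  fixes A :: "(real^'n) set"
  assumes "closed A" "convex C" "C \<subseteq> {0<..}"
    and curv: "\<And>x g. x \<in> A \<Longrightarrow> g \<in> C \<Longrightarrow> curvature TYPE('n) (g * (norm x)\<^sup>2) \<ge> 0"
  shows "convex_on C (region_prob A)"
  unfolding region_prob_def[abs_def]
proof (intro convex_on_set_integral)
  fix x assume x: "x \<in> A"
  obtain f' f'' where "\<And>g. g > 0 \<Longrightarrow> ((\<lambda>g. noise_density (1 / g) x) has_real_derivative f' g) (at g)"
    "\<And>g. g > 0 \<Longrightarrow> (f' has_real_derivative f'' g * curvature TYPE('n) (g * (norm x)\<^sup>2)) (at g)"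
    "\<And>g::real. g > 0 \<Longrightarrow> f'' g > 0"
    using noise_density_second_derivative[of x] by metis
  with x show "convex_on C (\<lambda>g. noise_density (1 / g) x)"
    using assms
    by (intro f''_ge0_imp_convex[where f'=f' and f''="\<lambda>g. f'' g * curvature TYPE('n) (g * (norm x)\<^sup>2)"])
      (auto intro!: mult_nonneg_nonneg less_imp_le[of 0 "f'' _"])
qed (use assms in \<open>auto intro!: set_integrable_noise_density\<close>)

lemma concave_on_region_prob:
  fixes A :: "(real^'n) set"
  assumes "closed A" "convex C" "C \<subseteq> {0<..}"
    and curv: "\<And>x g. x \<in> A \<Longrightarrow> g \<in> C \<Longrightarrow> curvature TYPE('n) (g * (norm x)\<^sup>2) \<le> 0"
  shows "concave_on C (region_prob A)"
  unfolding region_prob_def[abs_def]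
proof (intro concave_on_set_integral)
  fix x assume x: "x \<in> A"
  obtain f' f'' where "\<And>g. g > 0 \<Longrightarrow> ((\<lambda>g. noise_density (1 / g) x) has_real_derivative f' g) (at g)"
    "\<And>g. g > 0 \<Longrightarrow> (f' has_real_derivative f'' g * curvature TYPE('n) (g * (norm x)\<^sup>2)) (at g)"
    "\<And>g::real. g > 0 \<Longrightarrow> f'' g > 0"
    using noise_density_second_derivative[of x] by metis
  with x show "concave_on C (\<lambda>g. noise_density (1 / g) x)"
    using assms
    by (intro f''_le0_imp_concave[where f'=f' and f''="\<lambda>g. f'' g * curvature TYPE('n) (g * (norm x)\<^sup>2)"])
      (auto intro!: mult_nonneg_nonpos less_imp_le[of 0 "f'' _"])
qed (use assms in \<open>auto intro!: set_integrable_noise_density\<close>)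

section \<open>Bounded regions with interior: strict curvature signs and zeros\<close>

context
  fixes A :: "(real^'n) set"
  assumes closed: "closed A" and bdd: "bounded A" and int: "interior A \<noteq> {}"
begin

lemma finite_measure_region: "finite_measure (region_measure A)"
  using emeasure_bounded_finite[OF bdd] closed
  by (intro finite_measureI) (auto simp: emeasure_restrict_space space_restrict_space)

lemma measurable_region: "exponent \<in> borel_measurable (region_measure A)"
  unfolding exponent_def[abs_def] by (intro measurable_restrict_space1) simp

lemma bounded_exponent: "\<exists>B. \<forall>x\<in>space (region_measure A). \<bar>exponent x\<bar> \<le> B"
proof -
  obtain b where b: "\<forall>x\<in>A. norm x \<le> b" using bdd unfolding bounded_iff by blast
  have "\<bar>exponent x\<bar> \<le> b\<^sup>2 / 2" if "x \<in> space (region_measure A)" for x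
    using b that power_mono[of "norm x" b 2] by (simp add: exponent_def space_restrict_space)
  then show ?thesis by blast
qed

text \<open>Expanding the square at \<open>- 2 * g * exponent x\<close> leaves a combination of
  three moments, a form that also makes sense for complex \<open>g\<close>.\<close>

lemma region_curvature_eq:
  "region_curvature A g = real CARD('n) / 2 * (real CARD('n) / 2 - 1) * region_moment A 0 g
     + real CARD('n) * g * region_moment A 1 g + g\<^sup>2 * region_moment A 2 g"
proof -
  let ?p = "real CARD('n) / 2"
  obtain B where B: "\<forall>x\<in>space (region_measure A). \<bar>exponent x\<bar> \<le> B"
    using bounded_exponent by blast
  note I = integrable_laplace_moment[OF finite_measure_region measurable_region B, of _ g]
  have "region_curvature A g = (LINT x|region_measure A. ?p * (?p - 1) * (exponent x ^ 0 * exp (exponent x * g))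
     + 2 * ?p * g * (exponent x ^ 1 * exp (exponent x * g)) + g\<^sup>2 * (exponent x ^ 2 * exp (exponent x * g)))"
    unfolding region_curvature_def curvature_def
    by (rule Bochner_Integration.integral_cong) (simp_all add: exponent_def power2_eq_square field_simps)
  also have "\<dots> = ?p * (?p - 1) * region_moment A 0 g
     + 2 * ?p * g * region_moment A 1 g + g\<^sup>2 * region_moment A 2 g"
    by (simp only: laplace_moment_def of_real_eq_id id_apply Bochner_Integration.integral_add
        integral_mult_right_zero Bochner_Integration.integrable_add integrable_mult_right I)
  finally show ?thesis by simp
qed

text \<open>The factor \<open>\<sigma>\<close> covers both signs at once. If the integral vanished,
  so would its signed integrand almost everywhere, placing almost all of \<open>A\<close> on the two
  spheres where \<open>curvature\<close> is zero; these are null sets, whereas \<open>A\<close> has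
  interior.\<close>

lemma sgn_region_curvature:
  assumes "g > 0" "\<sigma> \<noteq> 0"
    and curv: "\<And>x. x \<in> A \<Longrightarrow> 0 \<le> \<sigma> * curvature TYPE('n) (g * (norm x)\<^sup>2)"
  shows "0 < \<sigma> * region_curvature A g"
proof -
  let ?p = "real CARD('n) / 2"
  define h where "h x = \<sigma> * (curvature TYPE('n) (g * (norm x)\<^sup>2) / 4 * exp (exponent x * g))"
    for x :: "real^'n"
  obtain B where B: "\<forall>x\<in>space (region_measure A). \<bar>exponent x\<bar> \<le> B"
    using bounded_exponent by blast
  note I = integrable_laplace_moment[OF finite_measure_region measurable_region B, of _ g]
  have "integrable (region_measure A) (\<lambda>x. \<sigma> * (?p * (?p - 1) * (exponent x ^ 0 * exp (exponent x * g))
     + 2 * ?p * g * (exponent x ^ 1 * exp (exponent x * g)) + g\<^sup>2 * (exponent x ^ 2 * exp (exponent x * g))))"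
    by (intro Bochner_Integration.integrable_add integrable_mult_right I)
  also have "(\<lambda>x. \<sigma> * (?p * (?p - 1) * (exponent x ^ 0 * exp (exponent x * g))
     + 2 * ?p * g * (exponent x ^ 1 * exp (exponent x * g)) + g\<^sup>2 * (exponent x ^ 2 * exp (exponent x * g)))) = h"
    by (auto simp: h_def exponent_def curvature_def power2_eq_square field_simps)
  finally have int_h: "integrable (region_measure A) h" .
  have eq: "\<sigma> * region_curvature A g = integral\<^sup>L (region_measure A) h"
    unfolding region_curvature_def h_def by simp
  have nonneg: "AE x in region_measure A. 0 \<le> h x"
    unfolding h_def using curv
    by (intro AE_I2) (auto simp: space_restrict_space mult.assoc[symmetric])
  have "integral\<^sup>L (region_measure A) h \<noteq> 0"
  proof
    assume "integral\<^sup>L (region_measure A) h = 0"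
    then have "AE x in region_measure A. h x = 0"
      using integral_nonneg_eq_0_iff_AE[OF int_h nonneg] by simp
    then have "AE x in lborel. x \<in> A \<longrightarrow> h x = 0"
      using closed by (subst (asm) AE_restrict_space_iff) auto
    \<comment> \<open>Negligible sets are null sets of the completed measure, so the argument moves
      there.\<close>
    then have ae: "AE x in lebesgue. x \<in> A \<longrightarrow> h x = 0"
      by (rule AE_completion)
    \<comment> \<open>Radii of the two zero spheres. In dimension 1 with \<open>e = -1\<close> the
      radicand is negative, and so is its \<open>sqrt\<close>, giving an empty sphere.\<close>
    define r where "r e = sqrt ((real CARD('n) + e * sqrt (2 * real CARD('n))) / g)" for e
    have "AE x in lebesgue. x \<notin> sphere (0::real^'n) (r e)" for e
      using negligible_sphere[of "0::real^'n" "r e"] unfolding negligible_iff_null_sets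
      by (rule AE_not_in)
    from ae this[of 1] this[of "-1"] have "AE x in lebesgue. x \<notin> A"
    proof eventually_elim
      case (elim x)
      show ?case
      proof
        assume "x \<in> A"
        then have "curvature TYPE('n) (g * (norm x)\<^sup>2) = 0"
          using elim assms(2) by (simp add: h_def)
        then obtain e where e: "e = 1 \<or> e = -1"
          "g * (norm x)\<^sup>2 = real CARD('n) + e * sqrt (2 * real CARD('n))"
          unfolding curvature_factor by force
        then have "norm x = r e"
          using \<open>g > 0\<close> unfolding r_def by (metis nonzero_mult_div_cancel_left norm_ge_zero
            order_less_irrefl real_sqrt_unique)
        then show False using elim e(1) by auto
      qed
    qed
    then have "negligible A"
      unfolding negligible_iff_null_sets using closed
      by (subst AE_iff_null_sets) auto
    then show False
      using int open_not_negligible[of "interior A"] negligible_subset[OF _ interior_subset] by auto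
  qed
  moreover have "integral\<^sup>L (region_measure A) h \<ge> 0" using nonneg by (rule integral_nonneg_AE)
  ultimately show ?thesis unfolding eq by simp
qed

text \<open>The probability is a constant times \<open>g powr (n / 2)\<close> times the moment of
  order 0, with \<open>n\<close> the dimension, so the product rule exhibits its second derivative
  as a positive factor times \<open>region_curvature\<close>.\<close>

lemma inflection_point_region_prob:
  assumes "g > 0"
  shows "inflection_point (region_prob A) g
    \<longleftrightarrow> region_curvature A g = 0 \<and> sign_change (region_curvature A) g"
proof -
  let ?p = "real CARD('n) / 2"
  obtain B where B: "\<forall>x\<in>space (region_measure A). \<bar>exponent x\<bar> \<le> B"
    using bounded_exponent by blast
  have D: "(region_moment A m has_real_derivative region_moment A (Suc m) g) (at g)"
    for m and g :: real
    by (rule has_field_derivative_laplace_moment[OF finite_measure_region measurable_region B])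
  define K where "K = (2 * pi) powr (- ?p)"
  define L where "L m = (region_moment A m :: real \<Rightarrow> real)" for m
  have L01: "(L 0 has_real_derivative L 1 g) (at g)" "(L 1 has_real_derivative L 2 g) (at g)" for g
    using D[of 0 g] D[of 1 g] by (simp_all add: numeral_2_eq_2 L_def)
  note D2 = powr_mult_second_derivative[where K=K and p="?p" and L="L 0" and L'="L 1" and L''="L 2",
      OF _ L01]
  have prob: "region_prob A g = K * (g powr ?p * L 0 g)" if "g > 0" for g
  proof -
    have "region_prob A g = (LINT x|region_measure A. noise_density (1 / g) x)"
      using closed unfolding region_prob_def set_lebesgue_integral_def
      by (subst integral_restrict_space) auto
    also have "\<dots> = (LINT x|region_measure A. K * (g powr ?p * exp (exponent x * g)))"
      using that by (simp add: noise_density_snr exponent_def K_def)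
    finally show ?thesis by (simp add: L_def laplace_moment_def)
  qed
  show ?thesis
  proof (rule inflection_point_iff_sign_change)
    show "open {0::real<..}" "g \<in> {0<..}" using assms by auto
    fix y :: real assume "y \<in> {0<..}"
    then have y: "y > 0" by simp
    have "eventually (\<lambda>g. region_prob A g = K * (g powr ?p * L 0 g)) (nhds y)"
      using eventually_nhds_in_open[of "{0<..}" y] y
      by (auto elim!: eventually_mono simp: prob)
    with D2(1)[OF y] show "(region_prob A has_real_derivative
        K * (?p * y powr (?p - 1) * L 0 y + y powr ?p * L 1 y)) (at y)"
      by (subst DERIV_cong_ev[OF refl _ refl])
    show "((\<lambda>y. K * (?p * y powr (?p - 1) * L 0 y + y powr ?p * L 1 y)) has_real_derivative
        K * y powr (?p - 2) * region_curvature A y) (at y)"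
      using D2(2)[OF y] by (simp add: region_curvature_eq L_def)
    show "K * y powr (?p - 2) > 0" using y by (simp add: K_def)
  qed
qed

text \<open>The parity count needs finitely many zeros. These come from complex analysis: the
  curvature extends to an entire function, which has finitely many zeros on a compact set unless it
  is constant.\<close>

lemma card_inflection_points_parity:
  assumes ab: "0 < a" "a \<le> b" and nz: "region_curvature A a \<noteq> 0" "region_curvature A b \<noteq> 0"
  defines "I \<equiv> {g \<in> {a..b}. inflection_point (region_prob A) g}"
  shows "finite I" "even (card I) \<longleftrightarrow> region_curvature A a * region_curvature A b > 0"
proof -
  let ?p = "real CARD('n) / 2"
  obtain B where B: "\<forall>x\<in>space (region_measure A). \<bar>exponent x\<bar> \<le> B"
    using bounded_exponent by blast
  note fmB = finite_measure_region measurable_region B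
  \<comment> \<open>The complex extension of \<open>region_curvature\<close>.\<close>
  define Q where "Q z = of_real (?p * (?p - 1)) * region_moment A 0 z
     + of_real (2 * ?p) * z * region_moment A 1 z + z\<^sup>2 * region_moment A 2 z" for z :: complex
  have Q_real: "Q (of_real g) = of_real (region_curvature A g)" for g
    unfolding Q_def region_curvature_eq laplace_moment_of_real[OF fmB] by simp
  have hol: "region_moment A m holomorphic_on (UNIV :: complex set)" for m
    unfolding holomorphic_on_def field_differentiable_def
    by (auto intro!: exI has_field_derivative_laplace_moment[OF fmB])
  have "Q holomorphic_on UNIV"
    unfolding Q_def[abs_def] by (intro holomorphic_intros hol)
  have zeros: "finite {g \<in> {a..b}. region_curvature A g = 0}"
  proof (cases "Q constant_on UNIV")
    case True
    \<comment> \<open>A constant extension has the nonzero value taken at \<open>a\<close>, hence no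
      zeros at all.\<close>
    then have const: "Q (of_real g) = Q (of_real a)" for g unfolding constant_on_def by auto
    have "region_curvature A g \<noteq> 0" for g using nz(1) const[of g] by (simp add: Q_real)
    then show ?thesis by simp
  next
    case False
    have "compact (complex_of_real ` {a..b})"
      by (intro compact_continuous_image continuous_intros) auto
    then have "finite {z \<in> complex_of_real ` {a..b}. Q z = 0}"
      using \<open>Q holomorphic_on UNIV\<close> False by (intro holomorphic_compact_finite_zeros[of Q UNIV]) auto
    moreover have "{z \<in> complex_of_real ` {a..b}. Q z = 0}
        = complex_of_real ` {g \<in> {a..b}. region_curvature A g = 0}"
      by (auto simp: Q_real)
    ultimately show ?thesis by (auto dest: finite_imageD simp: inj_on_def)
  qed
  have "isCont (region_moment A m) g" for m and g :: real
    by (rule DERIV_isCont has_field_derivative_laplace_moment[OF fmB])+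
  then have cont: "continuous_on {a..b} (region_curvature A)"
    unfolding region_curvature_eq[abs_def]
    by (intro continuous_intros continuous_at_imp_continuous_on ballI)
  have I: "I = {g \<in> {a..b}. region_curvature A g = 0 \<and> sign_change (region_curvature A) g}"
    using ab by (auto simp: I_def inflection_point_region_prob)
  show "finite I"
    unfolding I by (rule rev_finite_subset[OF zeros]) auto
  show "even (card I) \<longleftrightarrow> region_curvature A a * region_curvature A b > 0"
    unfolding I using cont zeros ab(2) nz by (rule card_sign_changes_parity)
qed

end

section \<open>The pairwise error probability\<close>

text \<open>\<open>c_lo\<close> and \<open>c_hi\<close> name the roots of \<open>curvature\<close>.
  As variables tied by equations they are replaced by the explicit expressions through
  \<open>refl\<close> in the end.\<close>

context
  fixes s :: "nat \<Rightarrow> real^'n" and M i j :: nat and c_lo c_hi :: real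
  assumes inj: "inj_on s {1..M}" and i: "i \<in> {1..M}" and j: "j \<in> {1..M}" and ij: "i \<noteq> j"
    and c_lo: "c_lo = real CARD('n) - sqrt (2 * real CARD('n))"
    and c_hi: "c_hi = real CARD('n) + sqrt (2 * real CARD('n))"
begin

abbreviation (input) "cell \<equiv> decision_region s M j"
abbreviation (input) "error_region \<equiv> (\<lambda>r. r - s i) ` cell"
abbreviation (input) "dmin \<equiv> d_min s M i"
abbreviation (input) "dmax \<equiv> dist (s i) (s j) + d_max s M j"

lemma pep_snr_eq_region_prob: "pep_snr s M i j = region_prob error_region"
  by (auto simp: fun_eq_iff pep_snr_def pep_def region_prob_def)

lemma closed_error_region: "closed error_region"
  using closed_translation_subtract[OF closed_decision_region] by blast

lemma interior_error_region: "interior error_region \<noteq> {}"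
  using center_in_interior_decision_region[OF inj j] by (auto simp: interior_translation_subtract)

lemma d_min_le_norm:
  assumes "x \<in> error_region"
  shows "dmin \<le> norm x"
  using assms d_min_le_dist[OF inj i j ij] by (auto simp: dist_norm norm_minus_commute)

lemma norm_le_d_max:
  assumes "bounded cell" "x \<in> error_region"
  shows "norm x \<le> dmax"
proof -
  obtain r where r: "r \<in> cell" "x = r - s i" using assms(2) by blast
  have "norm x \<le> dist (s i) (s j) + dist (s j) r"
    unfolding r(2) using dist_triangle[of "s i" r "s j"] by (simp add: dist_norm norm_minus_commute)
  with dist_le_d_max[OF assms(1) r(1)] show ?thesis by linarith
qed

text \<open>The shifted centre \<open>s j - s i\<close> lies in the error region, so its norm is
  between the two bounds. In particular \<open>dmax\<close> is positive.\<close>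

lemma d_min_le_d_max:
  assumes "bounded cell"
  shows "dmin \<le> dmax"
proof -
  have "s j \<in> cell" by (auto simp: decision_region_def)
  then have "s j - s i \<in> error_region" by blast
  then show ?thesis using d_min_le_norm norm_le_d_max[OF assms] order_trans by blast
qed

lemma bounded_error_region:
  assumes "bounded cell"
  shows "bounded error_region"
  using norm_le_d_max[OF assms] by (auto simp: bounded_iff)

lemma c_bounds: "c_hi > 0" "c_lo \<le> c_hi"
  by (simp_all add: c_lo c_hi add_pos_nonneg)

lemma high_snr_pos: "0 < c_hi / dmin\<^sup>2"
  using c_bounds(1) d_min_pos[OF inj i j ij] by simp

text \<open>High SNR pushes \<open>g * (norm x)\<^sup>2\<close> past the larger root throughout the
  error region.\<close>

lemma curvature_high_snr:
  assumes x: "x \<in> error_region" and g: "c_hi / dmin\<^sup>2 \<le> g"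
  shows "curvature TYPE('n) (g * (norm x)\<^sup>2) \<ge> 0"
proof -
  have d: "dmin > 0" by (rule d_min_pos[OF inj i j ij])
  have "c_hi \<le> g * dmin\<^sup>2" using g d by (simp add: pos_divide_le_eq)
  also have "\<dots> \<le> g * (norm x)\<^sup>2"
    using d_min_le_norm[OF x] d high_snr_pos g by (intro mult_left_mono power_mono) auto
  finally show ?thesis
    unfolding curvature_factor c_lo[symmetric] c_hi[symmetric] using c_bounds by (intro mult_nonneg_nonneg) linarith+
qed

lemma convex_high_snr: "convex_on {c_hi / dmin\<^sup>2 ..} (pep_snr s M i j)"
  unfolding pep_snr_eq_region_prob using closed_error_region curvature_high_snr high_snr_pos
  by (intro convex_on_region_prob) auto

lemma low_snr_bound:
  assumes "bounded cell" "x \<in> error_region" "0 < g" "g \<le> c / dmax\<^sup>2"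
  shows "g * (norm x)\<^sup>2 \<le> c"
proof -
  have "g * (norm x)\<^sup>2 \<le> g * dmax\<^sup>2"
    using assms(3) norm_le_d_max[OF assms(1,2)] by (intro mult_left_mono power_mono) auto
  also have "\<dots> \<le> c"
    using assms(4) d_min_le_d_max[OF assms(1)] d_min_pos[OF inj i j ij]
    by (simp add: pos_le_divide_eq)
  finally show ?thesis .
qed

lemma low_snr_pos:
  assumes "bounded cell" "0 < c"
  shows "0 < c / dmax\<^sup>2"
  using assms(2) d_min_le_d_max[OF assms(1)] d_min_pos[OF inj i j ij] by simp

text \<open>The curvature is strictly positive at the right endpoint, so its sign at the left
  endpoint alone decides the parity. The constant \<open>c\<close> is \<open>c_hi\<close> for
  dimensions 1 and 2, and \<open>c_lo\<close> above.\<close>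

lemma inflection_points_parity:
  assumes V: "bounded cell" and c: "0 < c" "c \<le> c_hi"
    and nz: "region_curvature error_region (c / dmax\<^sup>2) \<noteq> 0"
  defines "I \<equiv> {g \<in> {c / dmax\<^sup>2..c_hi / dmin\<^sup>2}. inflection_point (pep_snr s M i j) g}"
  shows "finite I" "even (card I) \<longleftrightarrow> region_curvature error_region (c / dmax\<^sup>2) > 0"
proof -
  note A = closed_error_region bounded_error_region[OF V] interior_error_region
  have pos: "region_curvature error_region (c_hi / dmin\<^sup>2) > 0"
    using sgn_region_curvature[OF A high_snr_pos, of 1] curvature_high_snr[OF _ order_refl] by simp
  have le: "c / dmax\<^sup>2 \<le> c_hi / dmin\<^sup>2"
    using c d_min_le_d_max[OF V] d_min_pos[OF inj i j ij] by (intro frac_le power_mono) auto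
  have nz': "region_curvature error_region (c_hi / dmin\<^sup>2) \<noteq> 0" using pos by simp
  note P = card_inflection_points_parity[OF A low_snr_pos[OF V c(1)] le nz nz']
  show "finite I" "even (card I) \<longleftrightarrow> region_curvature error_region (c / dmax\<^sup>2) > 0"
    using P pos by (simp_all add: I_def pep_snr_eq_region_prob zero_less_mult_iff)
qed

text \<open>Here \<open>c_lo\<close> is nonpositive, so at low SNR
  \<open>g * (norm x)\<^sup>2\<close> stays between the roots. The curvature is thus strictly
  negative at the left endpoint and positive at the right one.\<close>

lemma low_dimension:
  assumes dim: "CARD('n) = 1 \<or> CARD('n) = 2" and V: "bounded cell"
  defines "I \<equiv> {g \<in> {c_hi / dmax\<^sup>2..c_hi / dmin\<^sup>2}. inflection_point (pep_snr s M i j) g}"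
  shows "concave_on {0<..c_hi / dmax\<^sup>2} (pep_snr s M i j)" "finite I" "odd (card I)"
proof -
  note A = closed_error_region bounded_error_region[OF V] interior_error_region
  \<comment> \<open>For \<open>n\<close> equal to 1 or 2 the square of \<open>n\<close> is at most
    \<open>2 * n\<close>.\<close>
  have lo: "c_lo \<le> 0"
    unfolding c_lo using dim by (auto intro: real_le_rsqrt)
  have le: "curvature TYPE('n) (g * (norm x)\<^sup>2) \<le> 0"
    if x: "x \<in> error_region" and g: "0 < g" "g \<le> c_hi / dmax\<^sup>2" for x g
  proof -
    have "0 \<le> g * (norm x)\<^sup>2" using g by simp
    then show ?thesis
      unfolding curvature_factor c_lo[symmetric] c_hi[symmetric] using low_snr_bound[OF V x g] lo
      by (intro mult_nonneg_nonpos) linarith+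
  qed
  have pos: "0 < c_hi / dmax\<^sup>2" by (rule low_snr_pos[OF V c_bounds(1)])
  have neg: "region_curvature error_region (c_hi / dmax\<^sup>2) < 0"
    using sgn_region_curvature[OF A pos, of "-1"] le[OF _ pos order_refl] by simp
  then have nz: "region_curvature error_region (c_hi / dmax\<^sup>2) \<noteq> 0" by simp
  show "concave_on {0<..c_hi / dmax\<^sup>2} (pep_snr s M i j)"
    unfolding pep_snr_eq_region_prob using A(1) le by (intro concave_on_region_prob) auto
  show "finite I" "odd (card I)"
    using inflection_points_parity[OF V c_bounds(1) order_refl nz] neg by (simp_all add: I_def)
qed

text \<open>Now \<open>c_lo\<close> is positive, and low SNR keeps
  \<open>g * (norm x)\<^sup>2\<close> below both roots, so the curvature is strictly positive at
  both endpoints.\<close>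

lemma high_dimension:
  assumes dim: "CARD('n) > 2" and V: "bounded cell"
  defines "I \<equiv> {g \<in> {c_lo / dmax\<^sup>2..c_hi / dmin\<^sup>2}. inflection_point (pep_snr s M i j) g}"
  shows "convex_on {0<..c_lo / dmax\<^sup>2} (pep_snr s M i j)" "finite I" "even (card I)"
proof -
  note A = closed_error_region bounded_error_region[OF V] interior_error_region
  have "2 * real CARD('n) < (real CARD('n))\<^sup>2"
    using dim by (simp add: power2_eq_square)
  then have lo: "c_lo > 0" by (simp add: c_lo real_less_lsqrt)
  have ge: "curvature TYPE('n) (g * (norm x)\<^sup>2) \<ge> 0"
    if x: "x \<in> error_region" and g: "0 < g" "g \<le> c_lo / dmax\<^sup>2" for x g
    unfolding curvature_factor c_lo[symmetric] c_hi[symmetric] using low_snr_bound[OF V x g] c_bounds(2)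
    by (intro mult_nonpos_nonpos) linarith+
  have pos: "0 < c_lo / dmax\<^sup>2" by (rule low_snr_pos[OF V lo])
  have curv: "region_curvature error_region (c_lo / dmax\<^sup>2) > 0"
    using sgn_region_curvature[OF A pos, of 1] ge[OF _ pos order_refl] by simp
  then have nz: "region_curvature error_region (c_lo / dmax\<^sup>2) \<noteq> 0" by simp
  show "convex_on {0<..c_lo / dmax\<^sup>2} (pep_snr s M i j)"
    unfolding pep_snr_eq_region_prob using A(1) ge by (intro convex_on_region_prob) auto
  show "finite I" "even (card I)"
    using inflection_points_parity[OF V lo c_bounds(2) nz] curv by (simp_all add: I_def)
qed

end

theorem theorem3:
  fixes s :: "nat \<Rightarrow> real^'n" and M i j :: nat
  assumes "inj_on s {1..M}"
    and "1 / real M * (\<Sum>k=1..M. (norm (s k))\<^sup>2) = 1"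
    and "i \<in> {1..M}" and "j \<in> {1..M}" and "i \<noteq> j"
  shows
    "convex_on {(real CARD('n) + sqrt (2 * real CARD('n))) / (d_min s M i)\<^sup>2 ..} (pep_snr s M i j)
     \<and> (\<forall>v>0. 1 / v \<ge> (real CARD('n) + sqrt (2 * real CARD('n))) / (d_min s M i)\<^sup>2
           \<longleftrightarrow> (d_min s M i)\<^sup>2 \<ge> (real CARD('n) + sqrt (2 * real CARD('n))) * v)
     \<and> ((CARD('n) = 1 \<or> CARD('n) = 2) \<and> bounded (decision_region s M j) \<longrightarrow>
          concave_on {0 <.. (real CARD('n) + sqrt (2 * real CARD('n)))
                             / (dist (s i) (s j) + d_max s M j)\<^sup>2} (pep_snr s M i j)
          \<and> (let I = {\<gamma> \<in> {(real CARD('n) + sqrt (2 * real CARD('n)))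
                               / (dist (s i) (s j) + d_max s M j)\<^sup>2 ..
                             (real CARD('n) + sqrt (2 * real CARD('n))) / (d_min s M i)\<^sup>2}.
                       inflection_point (pep_snr s M i j) \<gamma>}
             in finite I \<and> odd (card I)))
     \<and> (CARD('n) > 2 \<and> bounded (decision_region s M j) \<longrightarrow>
          convex_on {0 <.. (real CARD('n) - sqrt (2 * real CARD('n)))
                            / (dist (s i) (s j) + d_max s M j)\<^sup>2} (pep_snr s M i j)
          \<and> (let I = {\<gamma> \<in> {(real CARD('n) - sqrt (2 * real CARD('n)))
                               / (dist (s i) (s j) + d_max s M j)\<^sup>2 ..
                             (real CARD('n) + sqrt (2 * real CARD('n))) / (d_min s M i)\<^sup>2}.
                       inflection_point (pep_snr s M i j) \<gamma>}
             in finite I \<and> even (card I)))"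
proof -
  note geo = assms(1,3,4,5)
  have "\<forall>v>0. 1 / v \<ge> (real CARD('n) + sqrt (2 * real CARD('n))) / (d_min s M i)\<^sup>2
      \<longleftrightarrow> (d_min s M i)\<^sup>2 \<ge> (real CARD('n) + sqrt (2 * real CARD('n))) * v"
    using d_min_pos[OF geo] by (auto simp: field_simps)
  then show ?thesis
    unfolding Let_def
    using convex_high_snr[OF geo refl refl] low_dimension[OF geo refl refl] high_dimension[OF geo refl refl]
    by (intro conjI impI) (elim conjE, assumption | simp)+
qed

end
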